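(* Let $0<b<\infty$, $\tau\ge0$, $\nu_0>0$, $p(x)>0$. For a weight $\omega\in[0,1]$, let the aggregated estimator $\widehat\Sigma_{A,t}(x)=\omega\widehat\Sigma_{S,t}(x)+(1-\omega)\widehat\Sigma_{T,t}$ have the asymptotic covariance matrix $\Omega(x)=\psi(\omega)\Lambda(x)$ (for $\sqrt{Nh}\,\mathrm{vech}(\widehat\Sigma_{A,t}(x))$), where $$\psi(\omega)=2\omega^2\nu_0p(x)^{-1}+b(1-\omega)^2\frac{\tau(1+e^\tau)}{e^\tau-1}.$$ Then $\psi$ attains its minimum at $$\omega_t(x)=\frac{b\tau(1+e^\tau)p(x)}{2\nu_0(e^\tau-1)+b\tau(1+e^\tau)p(x)} .$$ Consequently, for every portfolio allocation vector $\mathbf a\in\mathbb R^d$, this weight, which does not depend on $\mathbf a$, minimizes the asymptotic variance of $\mathbf a^T\widehat\Sigma_{A,t}(x)\mathbf a$ over weights, and the resulting asymptotic covariance coefficient is smaller than those of the state-domain estimator ($\omega=1$) and of the time-domain estimator ($\omega=0$).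
   Context: $\widehat\Sigma_{S,t}(x)$ (state-domain) and $\widehat\Sigma_{T,t}$ (time-domain) are symmetric $d\times d$ matrix estimators of a diffusion matrix $\Sigma(x)$ that are asymptotically jointly normal and asymptotically independent: up to centering, $\sqrt{Nh}\,\mathrm{vech}(\widehat\Sigma_{S,t}(x))$ has asymptotic covariance $2\nu_0p(x)^{-1}\Lambda(x)$, and $\sqrt n\,\mathrm{vech}(\widehat\Sigma_{T,t})$ has asymptotic covariance $\frac{\tau(1+e^\tau)}{e^\tau-1}\Lambda(x)$, with zero asymptotic cross-covariance, and $Nh/n\to b$. Here $\Lambda(x)=P_D\{\Sigma(x)\otimes\Sigma(x)\}P_D^T$, where $\mathrm{vech}$ is the vector of lower-triangular entries, $D$ is the zero-one matrix with $D\,\mathrm{vech}(A)=\mathrm{vec}(A)$ for symmetric $d\times d$ matrices $A$, and $P_D=(D^TD)^{-1}D^T$. $\nu_0=\int K^2$ for a kernel density $K$, and $p$ is the stationary density of the factor process. When $\tau=0$, $\tau(1+e^\tau)/(e^\tau-1)$ is read as its limit $2$, and the formula for $\omega_t(x)$ as its limit. *)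

theory Defs
  imports "HOL-Probability.Probability" "HOL-Real_Asymp.Real_Asymp"
begin

section \<open>Half-vectorisation and the duplication matrix\<close>

text \<open>
  Rows and columns of \<open>d \<times> d\<close> matrices are indexed by a finite linearly ordered type;
  \<open>vech\<close> is indexed by the positions \<open>(i, j)\<close> with \<open>j \<le> i\<close>. The covariance matrices below
  are therefore genuine matrices of order \<open>d (d + 1) / 2\<close>, up to the order in which the entries of
  \<open>vec\<close> and \<open>vech\<close> are listed, which the index types leave unspecified.
\<close>

typedef (overloaded) ('d::linorder) lowtri = "{(i::'d, j). j \<le> i}"
  by auto

instance lowtri :: ("{finite, linorder}") finite
proof
  have "UNIV = range (Abs_lowtri :: 'a \<times> 'a \<Rightarrow> 'a lowtri)"
    by (metis Rep_lowtri_inverse surj_def)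
  then show "finite (UNIV :: 'a lowtri set)"
    by (metis finite finite_imageI)
qed

definition vectorize :: "real^'d^'d \<Rightarrow> real^('d::finite \<times> 'd)" where
  "vectorize A = (\<chi> r. A $ fst r $ snd r)"

definition vech :: "real^('d::{finite, linorder})^('d::{finite, linorder}) \<Rightarrow> real^('d lowtri)" where
  "vech A = (\<chi> q. A $ fst (Rep_lowtri q) $ snd (Rep_lowtri q))"

text \<open>
  The pair \<open>(i, j)\<close> stands for the position of the matrix entry \<open>(i, j)\<close> in the column-stacked
  vector, so the block index is the second component and
  \<open>kronecker A B *v vectorize X = vectorize (B ** X ** transpose A)\<close>.
\<close>

definition kronecker :: "real^'d^'d \<Rightarrow> real^'d^'d \<Rightarrow> real^('d \<times> 'd)^('d::finite \<times> 'd)" where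
  "kronecker A B = (\<chi> r c. A $ snd r $ snd c * B $ fst r $ fst c)"

definition dup_mat :: "real^(('d::{finite, linorder}) lowtri)^('d \<times> 'd)" where
  "dup_mat = (\<chi> r q. if Rep_lowtri q = r \<or> Rep_lowtri q = (snd r, fst r) then 1 else 0)"

lemma dup_mat_vech:
  fixes A :: "real^('d::{finite, linorder})^('d::{finite, linorder})"
  assumes "transpose A = A"
  shows "dup_mat *v vech A = vectorize A"
proof -
  have sym: "A $ i $ j = A $ j $ i" for i j
    by (metis assms transpose_def vec_lambda_beta)
  have "(dup_mat *v vech A) $ r = vectorize A $ r" for r :: "'d \<times> 'd"
  proof -
    define r' where "r' = (max (fst r) (snd r), min (fst r) (snd r))"
    have r': "r' \<in> {(i, j). j \<le> i}"
      by (simp add: r'_def le_max_iff_disj)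
    have eq: "(Rep_lowtri q = r \<or> Rep_lowtri q = (snd r, fst r)) \<longleftrightarrow> q = Abs_lowtri r'"
      for q :: "'d lowtri"
    proof -
      have "(Rep_lowtri q = r \<or> Rep_lowtri q = (snd r, fst r)) \<longleftrightarrow> Rep_lowtri q = r'"
        using Rep_lowtri[of q] unfolding r'_def
        by (cases r; cases "Rep_lowtri q") (auto simp: max_def min_def)
      also have "\<dots> \<longleftrightarrow> q = Abs_lowtri r'"
        by (metis Abs_lowtri_inverse Rep_lowtri_inverse r')
      finally show ?thesis .
    qed
    have "(dup_mat *v vech A) $ r = (\<Sum>q\<in>UNIV. (if q = Abs_lowtri r' then vech A $ q else 0))"
      unfolding matrix_vector_mult_def dup_mat_def
      by (simp add: eq if_distrib[of "\<lambda>y. y * _"] cong: if_cong)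
    also have "\<dots> = vech A $ Abs_lowtri r'"
      by simp
    also have "\<dots> = vectorize A $ r"
      using r' sym[of "fst r" "snd r"]
      by (auto simp: vech_def vectorize_def Abs_lowtri_inverse r'_def max_def min_def)
    finally show ?thesis .
  qed
  then show ?thesis
    by (simp add: vec_eq_iff)
qed

lemma vech_surj_symmetric:
  fixes z :: "real^(('d::{finite, linorder}) lowtri)"
  obtains A :: "real^('d::{finite, linorder})^('d::{finite, linorder})" where "transpose A = A" "vech A = z"
proof
  define A :: "real^('d::{finite, linorder})^('d::{finite, linorder})" where "A = (\<chi> i j. z $ Abs_lowtri (max i j, min i j))"
  show "transpose A = A"
    by (simp add: A_def transpose_def max.commute min.commute)
  have "vech A $ q = z $ q" for q
  proof -
    obtain i j where q: "Rep_lowtri q = (i, j)" by fastforce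
    then have "j \<le> i" using Rep_lowtri[of q] by auto
    then have "(max i j, min i j) = Rep_lowtri q"
      by (simp add: q max_def min_def)
    then show ?thesis
      by (simp add: vech_def A_def q) (metis Rep_lowtri_inverse q)
  qed
  then show "vech A = z"
    by (simp add: vec_eq_iff)
qed

lemma dup_mat_unique:
  fixes E :: "real^(('d::{finite, linorder}) lowtri)^('d \<times> 'd)"
  assumes "\<And>A. transpose A = A \<Longrightarrow> E *v vech A = vectorize A"
  shows "E = dup_mat"
  unfolding matrix_eq
  by (metis assms dup_mat_vech vech_surj_symmetric)

definition dup_pinv :: "real^('d \<times> 'd)^(('d::{finite, linorder}) lowtri)" where
  "dup_pinv = matrix_inv (transpose dup_mat ** dup_mat) ** transpose dup_mat"

lemma invertible_dup_gram:
  "invertible (transpose dup_mat ** (dup_mat :: real^(('d::{finite, linorder}) lowtri)^('d \<times> 'd)))"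
proof -
  let ?D = "dup_mat :: real^('d lowtri)^('d \<times> 'd)"
  have "z = 0" if "(transpose ?D ** ?D) *v z = 0" for z
  proof -
    have "(?D *v z) \<bullet> (?D *v z) = 0"
      using that by (metis dot_lmul_matrix inner_zero_right matrix_vector_mul_assoc
          transpose_matrix_vector inner_commute)
    then have D0: "?D *v z = 0" by simp
    obtain A :: "real^('d::{finite, linorder})^('d::{finite, linorder})" where A: "transpose A = A" "vech A = z"
      by (rule vech_surj_symmetric)
    then have "vectorize A = 0"
      using D0 dup_mat_vech by metis
    then have "A $ i $ j = 0" for i j
      unfolding vectorize_def vec_eq_iff by simp
    then show ?thesis
      using A(2) by (auto simp: vech_def vec_eq_iff)
  qed
  then show ?thesis
    by (metis invertible_left_inverse matrix_left_invertible_ker)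
qed

definition Lambda :: "real^('d::{finite, linorder})^('d::{finite, linorder}) \<Rightarrow> real^('d lowtri)^('d lowtri)" where
  "Lambda A = dup_pinv ** kronecker A A ** transpose dup_pinv"


section \<open>Asymptotic normality\<close>

text \<open>
  The covariance of a law on a Euclidean space is represented by a self-adjoint operator \<open>V\<close>:
  on \<open>real^'m\<close> this is \<open>(*v) A\<close> for the covariance matrix \<open>A\<close>, on \<open>real\<close> it is \<open>(*) v\<close> for the
  variance \<open>v\<close>, and on a product space \<open>map_prod V W\<close> is the block-diagonal covariance of a pair
  with zero cross-covariance. A law is \<open>N(0, V)\<close> if each linear functional \<open>u\<close> has the law
  \<open>N(0, u \<bullet> V u)\<close>, where \<open>N(0, 0)\<close> is the point mass at 0.
\<close>

definition centered_normal :: "'a::euclidean_space measure \<Rightarrow> ('a \<Rightarrow> 'a) \<Rightarrow> bool" where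
  "centered_normal \<mu> V \<longleftrightarrow>
     prob_space \<mu> \<and> sets \<mu> = sets borel \<and>
     linear V \<and> (\<forall>u v. u \<bullet> V v = V u \<bullet> v) \<and> (\<forall>u. 0 \<le> u \<bullet> V u) \<and>
     (\<forall>u. distr \<mu> borel (\<lambda>z. u \<bullet> z) =
        (if u \<bullet> V u = 0 then return borel 0
         else density lborel (\<lambda>y. ennreal (normal_density 0 (sqrt (u \<bullet> V u)) y))))"

definition converges_in_distribution ::
  "(nat \<Rightarrow> 'w measure) \<Rightarrow> (nat \<Rightarrow> 'w \<Rightarrow> 'a::euclidean_space) \<Rightarrow> 'a measure \<Rightarrow> bool" where
  "converges_in_distribution M X \<mu> \<longleftrightarrow>
     (\<forall>k. X k \<in> borel_measurable (M k)) \<and>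
     (\<forall>f :: 'a \<Rightarrow> real. continuous_on UNIV f \<longrightarrow> bounded (range f) \<longrightarrow>
        (\<lambda>k. \<integral>w. f (X k w) \<partial>M k) \<longlonglongrightarrow> (\<integral>z. f z \<partial>\<mu>))"

definition asymptotically_normal ::
  "(nat \<Rightarrow> 'w measure) \<Rightarrow> (nat \<Rightarrow> 'w \<Rightarrow> 'a::euclidean_space) \<Rightarrow> ('a \<Rightarrow> 'a) \<Rightarrow> bool" where
  "asymptotically_normal M X V \<longleftrightarrow>
     (\<exists>\<mu>. centered_normal \<mu> V \<and> converges_in_distribution M X \<mu>)"


section \<open>Aggregation of the two estimators\<close>

definition aggregate :: "real \<Rightarrow> 'v \<Rightarrow> 'v \<Rightarrow> 'v::real_vector" where
  "aggregate \<omega> A B = \<omega> *\<^sub>R A + (1 - \<omega>) *\<^sub>R B"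

definition time_coeff :: "real \<Rightarrow> real" where
  "time_coeff \<tau> = (if \<tau> = 0 then 2 else \<tau> * (1 + exp \<tau>) / (exp \<tau> - 1))"

lemma time_coeff_limit: "((\<lambda>\<tau>::real. \<tau> * (1 + exp \<tau>) / (exp \<tau> - 1)) \<longlongrightarrow> 2) (at 0)"
  by real_asymp

definition agg_coeff :: "real \<Rightarrow> real \<Rightarrow> real \<Rightarrow> real \<Rightarrow> real \<Rightarrow> real" where
  "agg_coeff b \<tau> \<nu>0 px \<omega> = 2 * \<omega>\<^sup>2 * \<nu>0 * inverse px + b * (1 - \<omega>)\<^sup>2 * time_coeff \<tau>"

definition weight_formula :: "real \<Rightarrow> real \<Rightarrow> real \<Rightarrow> real \<Rightarrow> real" where
  "weight_formula b \<nu>0 px \<tau> =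
     b * \<tau> * (1 + exp \<tau>) * px / (2 * \<nu>0 * (exp \<tau> - 1) + b * \<tau> * (1 + exp \<tau>) * px)"

definition opt_weight :: "real \<Rightarrow> real \<Rightarrow> real \<Rightarrow> real \<Rightarrow> real" where
  "opt_weight b \<tau> \<nu>0 px =
     (if \<tau> = 0 then Lim (at_right 0) (weight_formula b \<nu>0 px) else weight_formula b \<nu>0 px \<tau>)"

lemma opt_weight_0:
  assumes "b > 0" "\<nu>0 > 0" "px > 0"
  shows "(weight_formula b \<nu>0 px \<longlongrightarrow> b * px / (\<nu>0 + b * px)) (at_right 0)"
    and "opt_weight b 0 \<nu>0 px = b * px / (\<nu>0 + b * px)"
proof -
  have c: "((\<lambda>\<tau>. \<tau> * (1 + exp \<tau>) / (exp \<tau> - 1)) \<longlongrightarrow> (2::real)) (at_right 0)"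
    by (rule tendsto_mono[OF at_le time_coeff_limit]) simp
  have "((\<lambda>\<tau>. b * (\<tau> * (1 + exp \<tau>) / (exp \<tau> - 1)) * px /
          (2 * \<nu>0 + b * (\<tau> * (1 + exp \<tau>) / (exp \<tau> - 1)) * px)) \<longlongrightarrow>
        b * 2 * px / (2 * \<nu>0 + b * 2 * px)) (at_right 0)"
    using assms by (intro tendsto_intros c) (simp add: add_pos_pos less_imp_neq[symmetric])
  moreover have "\<forall>\<^sub>F \<tau> in at_right 0. b * (\<tau> * (1 + exp \<tau>) / (exp \<tau> - 1)) * px /
          (2 * \<nu>0 + b * (\<tau> * (1 + exp \<tau>) / (exp \<tau> - 1)) * px) = weight_formula b \<nu>0 px \<tau>"
  proof (rule eventually_at_rightI[of 0 1])
    fix \<tau> :: real assume "\<tau> \<in> {0<..<1}"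
    then have e: "exp \<tau> - 1 \<noteq> 0" by simp
    show "b * (\<tau> * (1 + exp \<tau>) / (exp \<tau> - 1)) * px /
          (2 * \<nu>0 + b * (\<tau> * (1 + exp \<tau>) / (exp \<tau> - 1)) * px) = weight_formula b \<nu>0 px \<tau>"
    proof -
      define E where "E = exp \<tau> - 1"
      define X where "X = b * \<tau> * (1 + exp \<tau>) * px"
      have "E \<noteq> 0" using e by (simp add: E_def)
      have 1: "b * (\<tau> * (1 + exp \<tau>) / E) * px = X / E"
        by (simp add: X_def)
      have 2: "2 * \<nu>0 + X / E = (2 * \<nu>0 * E + X) / E"
        using \<open>E \<noteq> 0\<close> by (simp add: add_divide_distrib)
      have "X / E / ((2 * \<nu>0 * E + X) / E) = X / (2 * \<nu>0 * E + X)"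
        using \<open>E \<noteq> 0\<close> by simp
      then show ?thesis
        unfolding weight_formula_def E_def[symmetric] X_def[symmetric] 1 2 .
    qed
  qed simp
  moreover have "b * 2 * px / (2 * \<nu>0 + b * 2 * px) = b * px / (\<nu>0 + b * px)"
  proof -
    have "b * 2 * px = 2 * (b * px)" "2 * \<nu>0 + b * 2 * px = 2 * (\<nu>0 + b * px)"
      by (simp_all add: algebra_simps)
    then show ?thesis
      by (metis mult_divide_mult_cancel_left zero_neq_numeral)
  qed
  ultimately show lim: "(weight_formula b \<nu>0 px \<longlongrightarrow> b * px / (\<nu>0 + b * px)) (at_right 0)"
    using Lim_transform_eventually by fastforce
  show "opt_weight b 0 \<nu>0 px = b * px / (\<nu>0 + b * px)"
    using tendsto_Lim[OF _ lim] by (simp add: opt_weight_def)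
qed

end

(*
  Substituting sqrt (N h) = sqrt (N h / n) * sqrt n writes the scaled aggregated estimator as
  F (r, X) = \<omega> X1 + (1 - \<omega>) r X2, where X = (X1, X2) is the jointly normal pair and
  r = sqrt (N h / n) tends to sqrt b.  By a Slutsky argument the limit law is the linear image
  F (sqrt b, _) of a normal law with block-diagonal covariance, so the two covariances enter with
  weights \<omega>^2 and b (1 - \<omega>)^2.  A quadratic form of a symmetric matrix A is a linear functional of
  vech A, so its asymptotic variance is \<psi>(\<omega>) times a nonnegative number, and everything
  reduces to minimising the convex parabola \<psi>.
*)
theory Submission imports Defs begin

section \<open>Convergence in distribution\<close>

text \<open>Tightness of a single law, by dominated convergence with bound 1. The ramp is 0 on the
  ball of radius \<open>m\<close> and 1 outside radius \<open>m + 1\<close>. Being continuous,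
  unlike an indicator, it is a legitimate test function for weak convergence.\<close>

lemma integral_norm_tail_tendsto_0:
  fixes \<mu> :: "'a::euclidean_space measure"
  assumes "prob_space \<mu>" "sets \<mu> = sets borel"
  shows "(\<lambda>m. \<integral>z. min 1 (max 0 (norm z - real m)) \<partial>\<mu>) \<longlonglongrightarrow> 0"
proof -
  interpret prob_space \<mu> by fact
  have [measurable_cong]: "sets \<mu> = sets borel" by fact
  have "(\<lambda>m. \<integral>z. min 1 (max 0 (norm z - real m)) \<partial>\<mu>) \<longlonglongrightarrow> (\<integral>z. 0 \<partial>\<mu>)"
  proof (rule integral_dominated_convergence[where w = "\<lambda>_. 1"])
    have "(\<lambda>m. min 1 (max 0 (norm z - real m))) \<longlonglongrightarrow> 0" for z :: 'a
    proof (rule tendsto_eventually)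
      show "\<forall>\<^sub>F m in sequentially. min 1 (max 0 (norm z - real m)) = 0"
        using eventually_ge_at_top[of "nat \<lceil>norm z\<rceil>"]
        by eventually_elim linarith
    qed
    then show "AE z in \<mu>. (\<lambda>m. min 1 (max 0 (norm z - real m))) \<longlonglongrightarrow> 0"
      by simp
  qed auto
  then show ?thesis by simp
qed

text \<open>Slutsky's argument combined with the continuous mapping theorem, for a deterministic
  parameter \<open>c k\<close>. Replacing \<open>c k\<close> by \<open>c0\<close> costs a vanishing
  error: \<open>f\<close> after \<open>F\<close> is uniformly continuous on compact sets, and
  tightness controls the mass outside them.\<close>

lemma converges_in_distribution_continuous_image:
  fixes F :: "'c::euclidean_space \<times> 'a::euclidean_space \<Rightarrow> 'b::euclidean_space"
  assumes M: "\<And>k. prob_space (M k)"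
    and \<mu>: "prob_space \<mu>" "sets \<mu> = sets borel"
    and X: "converges_in_distribution M X \<mu>"
    and c: "c \<longlonglongrightarrow> c0"
    and F: "continuous_on UNIV F"
  shows "converges_in_distribution M (\<lambda>k w. F (c k, X k w)) (distr \<mu> borel (\<lambda>z. F (c0, z)))"
proof -
  have [measurable]: "X k \<in> borel_measurable (M k)" for k
    using X by (simp add: converges_in_distribution_def)
  have [measurable_cong]: "sets \<mu> = sets borel" by fact
  have Fcont: "continuous_on UNIV (\<lambda>z. F (y, z))" for y
    by (rule continuous_on_compose2[OF F]) (auto intro!: continuous_intros)
  have [measurable]: "(\<lambda>z. F (y, z)) \<in> borel_measurable borel" for y
    by (rule borel_measurable_continuous_onI[OF Fcont])
  have lim: "(\<lambda>k. \<integral>w. f (F (c k, X k w)) \<partial>M k) \<longlonglongrightarrow> (\<integral>z. f z \<partial>distr \<mu> borel (\<lambda>z. F (c0, z)))"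
    if f: "continuous_on UNIV f" "bounded (range f)" for f :: "'b \<Rightarrow> real"
  proof -
    have [measurable]: "f \<in> borel_measurable borel"
      by (rule borel_measurable_continuous_onI[OF f(1)])
    obtain B where B: "B > 0" "\<And>y. \<bar>f y\<bar> \<le> B"
      using f(2) unfolding bounded_pos by auto
    have f_int: "integrable (M k) (\<lambda>w. f (F (y, X k w)))" for k y
    proof -
      interpret prob_space "M k" by fact
      show ?thesis by (rule integrable_const_bound[where B = B]) (auto simp: B)
    qed
    have fF: "continuous_on UNIV (\<lambda>q. f (F q))"
      by (rule continuous_on_compose2[OF f(1) F]) auto
    \<comment> \<open>With the parameter frozen at \<open>c0\<close>, the integrand is itself a
      bounded continuous function of \<open>X k w\<close>.\<close>
    have fixed: "(\<lambda>k. \<integral>w. f (F (c0, X k w)) \<partial>M k) \<longlonglongrightarrow> (\<integral>z. f (F (c0, z)) \<partial>\<mu>)"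
    proof -
      have "continuous_on UNIV (\<lambda>z. f (F (c0, z)))"
        by (rule continuous_on_compose2[OF f(1) Fcont]) auto
      moreover have "bounded (range (\<lambda>z. f (F (c0, z))))"
        by (rule bounded_subset[OF f(2)]) auto
      ultimately show ?thesis
        using X unfolding converges_in_distribution_def by blast
    qed
    have "(\<lambda>k. (\<integral>w. f (F (c k, X k w)) \<partial>M k) - (\<integral>w. f (F (c0, X k w)) \<partial>M k)) \<longlonglongrightarrow> 0"
    proof (rule tendstoI)
      fix e :: real assume e: "e > 0"
      \<comment> \<open>The final bound on the error is \<open>\<delta> + 2 * B * \<delta>\<close>,
        which is \<open>e - \<delta>\<close> for this choice, hence strictly below
        \<open>e\<close>.\<close>
      define \<delta> where "\<delta> = e / (2 + 2 * B)"
      have \<delta>: "\<delta> > 0" using e B(1) by (simp add: \<delta>_def)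
      have "(2 + 2 * B) * \<delta> = e" using B(1) by (simp add: \<delta>_def)
      then have \<delta>_e: "\<delta> + 2 * B * \<delta> < e" using \<delta> by (simp add: algebra_simps)
      define \<phi> where "\<phi> = (\<lambda>m (z::'a). min 1 (max 0 (norm z - real m)))"
      have \<phi>_bounds: "0 \<le> \<phi> m z" "\<phi> m z \<le> 1" for m z by (auto simp: \<phi>_def)
      have \<phi>_cont: "continuous_on UNIV (\<phi> m)" for m
        unfolding \<phi>_def by (intro continuous_intros)
      have [measurable]: "\<phi> m \<in> borel_measurable borel" for m
        by (rule borel_measurable_continuous_onI[OF \<phi>_cont])
      have "\<forall>\<^sub>F m in sequentially. (\<integral>z. \<phi> m z \<partial>\<mu>) < \<delta>"
        using order_tendstoD(2)[OF integral_norm_tail_tendsto_0[OF \<mu>] \<delta>] by (simp add: \<phi>_def)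
      then obtain m where m: "(\<integral>z. \<phi> m z \<partial>\<mu>) < \<delta>"
        using eventually_happens'[OF sequentially_bot] by blast
      have "bounded (range (\<phi> m))"
        using \<phi>_bounds by (intro boundedI[of _ 1]) auto
      then have "(\<lambda>k. \<integral>w. \<phi> m (X k w) \<partial>M k) \<longlonglongrightarrow> (\<integral>z. \<phi> m z \<partial>\<mu>)"
        using X \<phi>_cont by (simp add: converges_in_distribution_def)
      then have tail: "\<forall>\<^sub>F k in sequentially. (\<integral>w. \<phi> m (X k w) \<partial>M k) < \<delta>"
        using m by (rule order_tendstoD(2))
      \<comment> \<open>Radius \<open>m + 1\<close> is where the ramp \<open>\<phi> m\<close>
        reaches 1, so its integral accounts for everything outside the second ball. The first ball
        eventually contains \<open>c k\<close>.\<close>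
      let ?K = "cball c0 1 \<times> cball (0::'a) (real m + 1)"
      have "uniformly_continuous_on ?K (\<lambda>q. f (F q))"
        by (intro compact_uniformly_continuous compact_Times compact_cball
            continuous_on_subset[OF fF]) auto
      then obtain \<eta> where \<eta>: "\<eta> > 0"
        "\<And>q q'. q \<in> ?K \<Longrightarrow> q' \<in> ?K \<Longrightarrow> dist q' q < \<eta> \<Longrightarrow> dist (f (F q')) (f (F q)) < \<delta>"
        using \<delta> unfolding uniformly_continuous_on_def by meson
      have near: "\<forall>\<^sub>F k in sequentially. dist (c k) c0 < min 1 \<eta>"
        using \<eta>(1) by (intro tendstoD[OF c]) simp
      show "\<forall>\<^sub>F k in sequentially.
        dist ((\<integral>w. f (F (c k, X k w)) \<partial>M k) - (\<integral>w. f (F (c0, X k w)) \<partial>M k)) 0 < e"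
        using near tail
      proof eventually_elim
        case (elim k)
        interpret prob_space "M k" by fact
        \<comment> \<open>Uniform continuity gives the \<open>\<delta>\<close> inside the ball;
          outside it \<open>\<phi> m z = 1\<close>, so the second summand absorbs the trivial bound
          \<open>2 * B\<close>.\<close>
        have pw: "\<bar>f (F (c k, z)) - f (F (c0, z))\<bar> \<le> \<delta> + 2 * B * \<phi> m z" for z
        proof (cases "norm z \<le> real m + 1")
          case True
          then have "dist (f (F (c k, z))) (f (F (c0, z))) < \<delta>"
            using elim(1) by (intro \<eta>(2)) (auto simp: dist_commute dist_Pair_Pair)
          moreover have "0 \<le> 2 * B * \<phi> m z"
            using B(1) \<phi>_bounds(1) by simp
          ultimately show ?thesis by (simp add: dist_real_def)
        next
          case False
          then have "\<phi> m z = 1" by (simp add: \<phi>_def)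
          then show ?thesis
            using B(2)[of "F (c k, z)"] B(2)[of "F (c0, z)"] \<delta> by simp
        qed
        have \<phi>_int: "integrable (M k) (\<lambda>w. \<phi> m (X k w))"
          by (rule integrable_const_bound[where B = 1]) (auto simp: \<phi>_bounds)
        have "\<bar>(\<integral>w. f (F (c k, X k w)) \<partial>M k) - (\<integral>w. f (F (c0, X k w)) \<partial>M k)\<bar>
            = \<bar>\<integral>w. f (F (c k, X k w)) - f (F (c0, X k w)) \<partial>M k\<bar>"
          by (simp add: f_int)
        also have "\<dots> \<le> (\<integral>w. \<bar>f (F (c k, X k w)) - f (F (c0, X k w))\<bar> \<partial>M k)"
          by (rule integral_abs_bound)
        also have "\<dots> \<le> (\<integral>w. \<delta> + 2 * B * \<phi> m (X k w) \<partial>M k)"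
          by (rule integral_mono) (auto simp: f_int \<phi>_int pw)
        also have "\<dots> = \<delta> + 2 * B * (\<integral>w. \<phi> m (X k w) \<partial>M k)"
          using \<phi>_int by (simp add: prob_space)
        also have "\<dots> < \<delta> + 2 * B * \<delta>"
          using elim(2) B(1) by simp
        also have "\<dots> < e" by (fact \<delta>_e)
        finally show ?case by (simp add: dist_real_def)
      qed
    qed
    from tendsto_add[OF this fixed] show ?thesis
      by (simp add: integral_distr)
  qed
  have "(\<lambda>w. F (c k, X k w)) \<in> borel_measurable (M k)" for k
    by measurable
  with lim show ?thesis by (simp add: converges_in_distribution_def)
qed

text \<open>Finitely many indices do not affect the limit, which allows for small \<open>k\<close>
  with \<open>n k = 0\<close>. Measurability of \<open>Y k\<close> is still demanded at every index,
  because the definition of convergence asks for it.\<close>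

lemma converges_in_distribution_cong:
  assumes X: "converges_in_distribution M X \<mu>"
    and Y: "\<And>k. Y k \<in> borel_measurable (M k)"
    and eq: "\<forall>\<^sub>F k in sequentially. \<forall>w\<in>space (M k). Y k w = X k w"
  shows "converges_in_distribution M Y \<mu>"
  unfolding converges_in_distribution_def
proof (intro conjI allI impI)
  fix f :: "'b \<Rightarrow> real" assume f: "continuous_on UNIV f" "bounded (range f)"
  have "\<forall>\<^sub>F k in sequentially. (\<integral>w. f (X k w) \<partial>M k) = (\<integral>w. f (Y k w) \<partial>M k)"
    using eq by eventually_elim (auto intro!: Bochner_Integration.integral_cong)
  moreover have "(\<lambda>k. \<integral>w. f (X k w) \<partial>M k) \<longlonglongrightarrow> (\<integral>z. f z \<partial>\<mu>)"
    using X f by (simp add: converges_in_distribution_def)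
  ultimately show "(\<lambda>k. \<integral>w. f (Y k w) \<partial>M k) \<longlonglongrightarrow> (\<integral>z. f z \<partial>\<mu>)"
    by (rule Lim_transform_eventually[rotated])
qed (fact Y)


section \<open>Linear images of normal laws\<close>

text \<open>The functional \<open>u\<close> of the image is the functional
  \<open>adjoint G u\<close> of the original law, so the covariance becomes \<open>G\<close> after
  \<open>V\<close> after \<open>adjoint G\<close>.\<close>

lemma centered_normal_linear_image:
  fixes G :: "'a::euclidean_space \<Rightarrow> 'b::euclidean_space"
  assumes \<mu>: "centered_normal \<mu> V" and G: "linear G"
  shows "centered_normal (distr \<mu> borel G) (\<lambda>u. G (V (adjoint G u)))"
proof -
  have cn: "prob_space \<mu>" "sets \<mu> = sets borel" "linear V"
      "\<And>u v. u \<bullet> V v = V u \<bullet> v" "\<And>u. 0 \<le> u \<bullet> V u"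
      "\<And>u. distr \<mu> borel (\<lambda>z. u \<bullet> z) = (if u \<bullet> V u = 0 then return borel 0
         else density lborel (\<lambda>y. ennreal (normal_density 0 (sqrt (u \<bullet> V u)) y)))"
    using \<mu> unfolding centered_normal_def by auto
  have [measurable_cong]: "sets \<mu> = sets borel" by fact
  have [measurable]: "G \<in> borel_measurable borel"
    by (intro borel_measurable_continuous_onI linear_continuous_on linear_conv_bounded_linear[THEN iffD1] G)
  have adj: "u \<bullet> G z = adjoint G u \<bullet> z" for u z
    using adjoint_works[OF G, of z u] by (simp add: inner_commute)
  have adj': "G z \<bullet> u = z \<bullet> adjoint G u" for u z
    using adj by (metis inner_commute)
  have "prob_space (distr \<mu> borel G)"
    by (rule prob_space.prob_space_distr[OF cn(1)]) measurable
  moreover have "linear (\<lambda>u. G (V (adjoint G u)))"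
    using linear_compose[OF linear_compose[OF adjoint_linear[OF G] cn(3)] G] by (simp add: o_def)
  moreover have "distr (distr \<mu> borel G) borel (\<lambda>z. u \<bullet> z) = distr \<mu> borel (\<lambda>z. adjoint G u \<bullet> z)" for u
    by (subst distr_distr) (auto simp: o_def adj)
  \<comment> \<open>As a rewrite rule, \<open>cn(4)\<close> moves \<open>V\<close> to the left of
    each inner product; nonnegativity is therefore brought to that form first.\<close>
  ultimately show ?thesis
    unfolding centered_normal_def by (simp add: adj adj' cn(4,6) cn(5)[unfolded cn(4)])
qed

text \<open>A delta method with explicit data: \<open>A\<close> is the adjoint of the limiting map
  and \<open>W\<close> the transported covariance. Joint continuity of \<open>F\<close> handles the
  moving parameter; linearity is asked only at \<open>c0\<close>.\<close>

lemma asymptotically_normal_linear_image: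
  fixes F :: "'c::euclidean_space \<times> 'a::euclidean_space \<Rightarrow> 'b::euclidean_space"
  assumes M: "\<And>k. prob_space (M k)"
    and X: "asymptotically_normal M X V"
    and c: "c \<longlonglongrightarrow> c0"
    and F: "continuous_on UNIV F" "linear (\<lambda>z. F (c0, z))"
    and adj: "\<And>u z. u \<bullet> F (c0, z) = A u \<bullet> z"
    and W: "\<And>u. W u = F (c0, V (A u))"
    and Y: "\<And>k. Y k \<in> borel_measurable (M k)"
      "\<forall>\<^sub>F k in sequentially. \<forall>w\<in>space (M k). Y k w = F (c k, X k w)"
  shows "asymptotically_normal M Y W"
proof -
  obtain \<mu> where \<mu>: "centered_normal \<mu> V" "converges_in_distribution M X \<mu>"
    using X by (auto simp: asymptotically_normal_def)
  have A: "adjoint (\<lambda>z. F (c0, z)) = A"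
    by (rule adjoint_unique) (metis adj inner_commute)
  have "prob_space \<mu>" "sets \<mu> = sets borel"
    using \<mu>(1) by (auto simp: centered_normal_def)
  from converges_in_distribution_continuous_image[OF M this \<mu>(2) c F(1)]
  have "converges_in_distribution M Y (distr \<mu> borel (\<lambda>z. F (c0, z)))"
    using Y by (rule converges_in_distribution_cong)
  moreover have "W = (\<lambda>u. F (c0, V (A u)))" using W by auto
  ultimately show ?thesis
    using centered_normal_linear_image[OF \<mu>(1) F(2)]
    by (auto simp: asymptotically_normal_def A)
qed


section \<open>Quadratic forms in terms of the half-vectorisation\<close>

lemma linear_vech: "linear vech"
  by (rule linearI) (auto simp: vech_def vec_eq_iff)

lemma vech_aggregate: "vech (aggregate \<omega> A B) = aggregate \<omega> (vech A) (vech B)"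
  by (simp add: aggregate_def linear_add[OF linear_vech] linear_scale[OF linear_vech])

lemma borel_measurable_vech [measurable]: "vech \<in> borel_measurable borel"
  by (intro borel_measurable_continuous_onI linear_continuous_on
      linear_conv_bounded_linear[THEN iffD1] linear_vech)

text \<open>The form is the inner product of the vectorised matrix of products
  \<open>a $ i * a $ j\<close> with \<open>vectorize A\<close>. Symmetry turns the latter into
  \<open>dup_mat *v vech A\<close>, and \<open>dup_mat\<close> moves to the other side as its
  transpose.\<close>

lemma quadratic_form_eq_inner_vech:
  fixes A :: "real^('d::{finite, linorder})^('d::{finite, linorder})"
  assumes "transpose A = A"
  shows "a \<bullet> (A *v a) = (transpose dup_mat *v (\<chi> r. a $ fst r * a $ snd r)) \<bullet> vech A"
proof -
  let ?c = "\<chi> r. a $ fst r * a $ snd r :: real^('d \<times> 'd)"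
  have "a \<bullet> (A *v a) = ?c \<bullet> vectorize A"
    by (simp add: inner_vec_def matrix_vector_mult_def vectorize_def sum_distrib_left
        UNIV_Times_UNIV[symmetric] sum.cartesian_product case_prod_beta mult_ac
        del: UNIV_Times_UNIV)
  also have "\<dots> = ?c \<bullet> (dup_mat *v vech A)"
    using dup_mat_vech[OF assms] by simp
  also have "\<dots> = (transpose dup_mat *v ?c) \<bullet> vech A"
    by (simp add: dot_lmul_matrix)
  finally show ?thesis .
qed

lemma transpose_aggregate:
  fixes A B :: "real^'d^'d"
  assumes "transpose A = A" "transpose B = B"
  shows "transpose (aggregate \<omega> A B) = aggregate \<omega> A B"
proof -
  have "A $ i $ j = A $ j $ i" "B $ i $ j = B $ j $ i" for i j
    by (metis assms transpose_def vec_lambda_beta)+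
  then show ?thesis
    by (simp add: aggregate_def transpose_def vec_eq_iff)
qed


section \<open>The optimal weight\<close>

lemma time_coeff_pos:
  assumes "0 \<le> \<tau>"
  shows "0 < time_coeff \<tau>"
  using assms by (auto simp: time_coeff_def intro!: divide_pos_pos mult_pos_pos add_pos_pos)

text \<open>Dividing numerator and denominator of the weight by \<open>q * (exp \<tau> - 1)\<close>
  gives a form that also covers the limiting case \<open>\<tau> = 0\<close>, where
  \<open>time_coeff\<close> is 2.\<close>

lemma opt_weight_eq:
  assumes "0 < b" "0 \<le> \<tau>" "0 < \<nu>0" "0 < q"
  shows "opt_weight b \<tau> \<nu>0 q =
    b * time_coeff \<tau> / (2 * \<nu>0 * inverse q + b * time_coeff \<tau>)"
proof (cases "\<tau> = 0")
  case True
  have "\<nu>0 + b * q > 0" using assms by (simp add: add_pos_pos)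
  then show ?thesis
    using True assms by (simp add: opt_weight_0(2) time_coeff_def field_simps)
next
  case False
  define E where "E = exp \<tau> - 1"
  define t where "t = \<tau> * (1 + exp \<tau>)"
  have pos: "E > 0" "t > 0"
    using False assms by (auto simp: E_def t_def add_pos_pos)
  have sum: "2 * \<nu>0 * inverse q + b * (t / E) = (2 * \<nu>0 * E + b * t * q) / (q * E)"
    using pos assms by (simp add: field_simps)
  have "opt_weight b \<tau> \<nu>0 q = b * t * q / (2 * \<nu>0 * E + b * t * q)"
    using False by (simp add: opt_weight_def weight_formula_def E_def t_def mult_ac)
  also have "\<dots> = b * (t / E) / (2 * \<nu>0 * inverse q + b * (t / E))"
    unfolding sum using pos assms by simp
  also have "t / E = time_coeff \<tau>"
    using False by (simp add: time_coeff_def E_def t_def)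
  finally show ?thesis .
qed

text \<open>Completing the square exhibits the minimiser \<open>B / (A + B)\<close> and the minimum
  value \<open>A * B / (A + B)\<close>.\<close>

lemma weighted_squares_eq:
  fixes A B \<omega> :: real
  assumes "0 < A" "0 < B"
  shows "A * \<omega>\<^sup>2 + B * (1 - \<omega>)\<^sup>2 = A * B / (A + B) + (A + B) * (\<omega> - B / (A + B))\<^sup>2"
proof -
  have "A + B \<noteq> 0" using assms by simp
  then show ?thesis
    by (simp add: divide_simps power2_eq_square) (simp add: algebra_simps)
qed

text \<open>The function \<open>avar\<close> is existential but determined on \<open>{0..1}\<close>:
  weak limits are unique, and a centered normal law on the line determines its variance.\<close>

theorem mainTheorem4:
  fixes b \<tau> \<nu>0 :: real
    and p :: "'x \<Rightarrow> real"
    and \<Sigma> :: "'x \<Rightarrow> real^('d::{finite, linorder})^('d::{finite, linorder})"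
    and x :: 'x
    and N n :: "nat \<Rightarrow> nat"
    and h :: "nat \<Rightarrow> real"
    and M :: "nat \<Rightarrow> 'w measure"
    and S T :: "nat \<Rightarrow> 'w \<Rightarrow> real^('d::{finite, linorder})^('d::{finite, linorder})"
    and cS cT :: "nat \<Rightarrow> real^('d::{finite, linorder})^('d::{finite, linorder})"
  assumes b: "0 < b" and tau: "0 \<le> \<tau>" and nu0: "0 < \<nu>0" and px: "0 < p x"
    and diffusion: "transpose (\<Sigma> x) = \<Sigma> x" "\<And>v. 0 \<le> v \<bullet> (\<Sigma> x *v v)"
    and bandwidth: "\<And>k. 0 < h k"
    and sample_size: "filterlim n at_top sequentially"
    and ratio: "(\<lambda>k. real (N k) * h k / real (n k)) \<longlonglongrightarrow> b"
    and prob: "\<And>k. prob_space (M k)"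
    and S_meas: "\<And>k. S k \<in> borel_measurable (M k)"
    and T_meas: "\<And>k. T k \<in> borel_measurable (M k)"
    and S_sym: "\<And>k w. w \<in> space (M k) \<Longrightarrow> transpose (S k w) = S k w"
    and T_sym: "\<And>k w. w \<in> space (M k) \<Longrightarrow> transpose (T k w) = T k w"
    and centering: "\<And>k. transpose (cS k) = cS k" "\<And>k. transpose (cT k) = cT k"
    and joint: "asymptotically_normal M
      (\<lambda>k w. (sqrt (real (N k) * h k) *\<^sub>R (vech (S k w) - vech (cS k)),
              sqrt (real (n k)) *\<^sub>R (vech (T k w) - vech (cT k))))
      (map_prod ((*v) ((2 * \<nu>0 * inverse (p x)) *\<^sub>R Lambda (\<Sigma> x)))
                ((*v) (time_coeff \<tau> *\<^sub>R Lambda (\<Sigma> x))))"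
  shows
    "(\<forall>\<omega>\<in>{0..1}. asymptotically_normal M
        (\<lambda>k w. sqrt (real (N k) * h k) *\<^sub>R
           (vech (aggregate \<omega> (S k w) (T k w)) - vech (aggregate \<omega> (cS k) (cT k))))
        ((*v) (agg_coeff b \<tau> \<nu>0 (p x) \<omega> *\<^sub>R Lambda (\<Sigma> x)))) \<and>
     opt_weight b \<tau> \<nu>0 (p x) \<in> {0..1} \<and>
     (\<forall>\<omega>\<in>{0..1}.
        agg_coeff b \<tau> \<nu>0 (p x) (opt_weight b \<tau> \<nu>0 (p x)) \<le> agg_coeff b \<tau> \<nu>0 (p x) \<omega>) \<and>
     (\<forall>a :: real^('d::{finite, linorder}). \<exists>avar :: real \<Rightarrow> real.
        (\<forall>\<omega>\<in>{0..1}. asymptotically_normal M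
           (\<lambda>k w. sqrt (real (N k) * h k) *
              (a \<bullet> (aggregate \<omega> (S k w) (T k w) *v a) - a \<bullet> (aggregate \<omega> (cS k) (cT k) *v a)))
           ((*) (avar \<omega>))) \<and>
        (\<forall>\<omega>\<in>{0..1}. avar (opt_weight b \<tau> \<nu>0 (p x)) \<le> avar \<omega>)) \<and>
     agg_coeff b \<tau> \<nu>0 (p x) (opt_weight b \<tau> \<nu>0 (p x)) < agg_coeff b \<tau> \<nu>0 (p x) 1 \<and>
     agg_coeff b \<tau> \<nu>0 (p x) (opt_weight b \<tau> \<nu>0 (p x)) < agg_coeff b \<tau> \<nu>0 (p x) 0"
proof -
  let ?w = "opt_weight b \<tau> \<nu>0 (p x)"
  let ?\<psi> = "agg_coeff b \<tau> \<nu>0 (p x)"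
  let ?L = "Lambda (\<Sigma> x)"
  let ?V = "map_prod ((*v) ((2 * \<nu>0 * inverse (p x)) *\<^sub>R ?L)) ((*v) (time_coeff \<tau> *\<^sub>R ?L))"
  \<comment> \<open>\<open>A\<close> and \<open>B\<close> are the coefficients of
    \<open>\<omega>\<^sup>2\<close> and \<open>(1 - \<omega>)\<^sup>2\<close> in the parabola; the
    factor \<open>b\<close> from the change of scaling sits in \<open>B\<close>.\<close>
  define A where "A = 2 * \<nu>0 * inverse (p x)"
  define B where "B = b * time_coeff \<tau>"
  have A: "A > 0" using nu0 px by (simp add: A_def)
  have B: "B > 0" using b time_coeff_pos[OF tau] by (simp add: B_def)
  have w: "?w = B / (A + B)"
    using opt_weight_eq[OF b tau nu0 px] by (simp add: A_def B_def)
  \<comment> \<open>Strict bounds keep the minimiser away from 0 and 1, which yields the two strict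
    comparisons at the end.\<close>
  have w01: "0 < ?w" "?w < 1" using A B by (simp_all add: w)
  have \<psi>: "?\<psi> \<omega> = A * B / (A + B) + (A + B) * (\<omega> - ?w)\<^sup>2" for \<omega>
  proof -
    have "?\<psi> \<omega> = A * \<omega>\<^sup>2 + B * (1 - \<omega>)\<^sup>2"
      by (simp add: agg_coeff_def A_def B_def mult_ac)
    then show ?thesis using weighted_squares_eq[OF A B, of \<omega>] by (simp add: w)
  qed
  have \<psi>_le: "?\<psi> ?w \<le> ?\<psi> \<omega>" for \<omega>
    using A B by (simp add: \<psi>)
  have \<psi>_less: "?\<psi> ?w < ?\<psi> \<omega>" if "\<omega> \<noteq> ?w" for \<omega>
    using A B that by (simp add: \<psi>)

  let ?r = "\<lambda>k. sqrt (real (N k) * h k / real (n k))"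
  have [measurable]: "S k \<in> borel_measurable (M k)" "T k \<in> borel_measurable (M k)" for k
    by (fact S_meas T_meas)+
  \<comment> \<open>Needed to cancel \<open>sqrt (real (n k))\<close> in the change of scaling
    below.\<close>
  have n_pos: "\<forall>\<^sub>F k in sequentially. n k > 0"
    using filterlim_at_top[THEN iffD1, OF sample_size, rule_format, of 1]
    by eventually_elim simp
  \<comment> \<open>The argument is \<open>(r, (X1, X2))\<close>: the random ratio of scalings is
    replaced by a deterministic parameter \<open>r\<close> with limit \<open>sqrt b\<close>.\<close>
  let ?F = "\<lambda>\<omega> q. \<omega> *\<^sub>R fst (snd q) + ((1 - \<omega>) * fst q) *\<^sub>R snd (snd q)"
  have agg_normal: "asymptotically_normal M
        (\<lambda>k w. sqrt (real (N k) * h k) *\<^sub>R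
           (vech (aggregate \<omega> (S k w) (T k w)) - vech (aggregate \<omega> (cS k) (cT k))))
        ((*v) (?\<psi> \<omega> *\<^sub>R ?L))" for \<omega>
  proof (rule asymptotically_normal_linear_image[OF prob joint,
        where c = ?r and ?c0.0 = "sqrt b"
          and F = "?F \<omega>"
          and A = "\<lambda>u. (\<omega> *\<^sub>R u, ((1 - \<omega>) * sqrt b) *\<^sub>R u)"])
    show "?r \<longlonglongrightarrow> sqrt b"
      using ratio by (rule tendsto_real_sqrt)
    \<comment> \<open>Each block is scaled once by the adjoint and once by the map itself, giving
      \<open>\<omega>\<^sup>2\<close> and \<open>(1 - \<omega>)\<^sup>2\<close> times the square of
      \<open>sqrt b\<close>.\<close>
    show "(?\<psi> \<omega> *\<^sub>R ?L) *v u =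
      ?F \<omega> (sqrt b, ?V (\<omega> *\<^sub>R u, ((1 - \<omega>) * sqrt b) *\<^sub>R u))" for u
      using b by (simp add: agg_coeff_def scaleR_matrix_vector_assoc[symmetric]
          matrix_vector_mult_scaleR matrix_vector_mult_add_rdistrib scaleR_add_left
          power2_eq_square mult_ac)
    show "(\<lambda>w. sqrt (real (N k) * h k) *\<^sub>R
           (vech (aggregate \<omega> (S k w) (T k w)) - vech (aggregate \<omega> (cS k) (cT k))))
        \<in> borel_measurable (M k)" for k
      unfolding aggregate_def by measurable
    show "\<forall>\<^sub>F k in sequentially. \<forall>w\<in>space (M k).
       sqrt (real (N k) * h k) *\<^sub>R
         (vech (aggregate \<omega> (S k w) (T k w)) - vech (aggregate \<omega> (cS k) (cT k))) =
       ?F \<omega> (?r k, sqrt (real (N k) * h k) *\<^sub>R (vech (S k w) - vech (cS k)),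
         sqrt (real (n k)) *\<^sub>R (vech (T k w) - vech (cT k)))"
      using n_pos
    proof eventually_elim
      case (elim k)
      define s where "s = sqrt (real (N k) * h k)"
      have s: "?r k * sqrt (real (n k)) = s"
        using elim by (simp add: real_sqrt_divide s_def)
      show ?case
        unfolding s_def[symmetric] fst_conv snd_conv scaleR_scaleR mult.assoc s
        by (simp add: vech_aggregate) (simp add: aggregate_def algebra_simps)
    qed
  qed (auto intro!: continuous_intros linearI simp: algebra_simps inner_simps)

  \<comment> \<open>Nonnegativity is part of being the covariance of the joint limit law. Testing it
    on \<open>(u, 0)\<close> isolates the state block, whose factor \<open>A\<close> is
    positive.\<close>
  have L_nonneg: "0 \<le> u \<bullet> (?L *v u)" for u
  proof -
    have "0 \<le> (u, 0) \<bullet> ?V (u, 0)"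
      using joint unfolding asymptotically_normal_def centered_normal_def by blast
    then have "0 \<le> A * (u \<bullet> (?L *v u))"
      by (simp add: A_def scaleR_matrix_vector_assoc[symmetric])
    then show ?thesis using A by (simp add: zero_le_mult_iff)
  qed

  have quadratic: "\<exists>avar. (\<forall>\<omega>\<in>{0..1}. asymptotically_normal M
           (\<lambda>k w. sqrt (real (N k) * h k) *
              (a \<bullet> (aggregate \<omega> (S k w) (T k w) *v a) - a \<bullet> (aggregate \<omega> (cS k) (cT k) *v a)))
           ((*) (avar \<omega>))) \<and> (\<forall>\<omega>\<in>{0..1}. avar ?w \<le> avar \<omega>)" for a :: "real^('d::{finite, linorder})"
  proof (intro exI conjI ballI)
    define u where "u = transpose dup_mat *v (\<chi> r. a $ fst r * a $ snd r :: real^('d \<times> 'd))"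
    \<comment> \<open>This fixes the witness for \<open>avar\<close>: the parabola times a factor
      depending on \<open>a\<close> but not on \<open>\<omega>\<close>. That factor may vanish, so
      only a weak inequality results.\<close>
    show "?\<psi> ?w * (u \<bullet> (?L *v u)) \<le> ?\<psi> \<omega> * (u \<bullet> (?L *v u))" for \<omega>
      using \<psi>_le L_nonneg by (rule mult_right_mono)
    fix \<omega> :: real
    have cont: "continuous_on UNIV (\<lambda>Q :: real^('d::{finite, linorder})^('d::{finite, linorder}). a \<bullet> (Q *v a))"
      by (simp add: matrix_vector_mult_def inner_vec_def) (intro continuous_intros)
    have [measurable]: "(\<lambda>Q :: real^('d::{finite, linorder})^('d::{finite, linorder}). a \<bullet> (Q *v a)) \<in> borel_measurable borel"
      by (rule borel_measurable_continuous_onI[OF cont])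
    show "asymptotically_normal M
           (\<lambda>k w. sqrt (real (N k) * h k) *
              (a \<bullet> (aggregate \<omega> (S k w) (T k w) *v a) - a \<bullet> (aggregate \<omega> (cS k) (cT k) *v a)))
           ((*) (?\<psi> \<omega> * (u \<bullet> (?L *v u))))"
    proof (rule asymptotically_normal_linear_image[OF prob agg_normal[of \<omega>],
          \<comment> \<open>Nothing moves with \<open>k\<close> here: the parameter is a dummy
            constant 0, which \<open>F\<close> ignores.\<close>
          where c = "\<lambda>_. 0 :: real" and ?c0.0 = 0
            and F = "\<lambda>q. u \<bullet> snd q" and A = "\<lambda>y. y *\<^sub>R u"])
      show "(\<lambda>w. sqrt (real (N k) * h k) *
              (a \<bullet> (aggregate \<omega> (S k w) (T k w) *v a) - a \<bullet> (aggregate \<omega> (cS k) (cT k) *v a)))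
          \<in> borel_measurable (M k)" for k
      proof -
        have [measurable]: "(\<lambda>w. aggregate \<omega> (S k w) (T k w)) \<in> borel_measurable (M k)"
          unfolding aggregate_def by measurable
        have "(\<lambda>w. a \<bullet> (aggregate \<omega> (S k w) (T k w) *v a)) \<in> borel_measurable (M k)"
          by (rule measurable_compose[of "\<lambda>w. aggregate \<omega> (S k w) (T k w)" _ borel]) measurable
        then show ?thesis by measurable
      qed
      show "\<forall>\<^sub>F k in sequentially. \<forall>w\<in>space (M k).
         sqrt (real (N k) * h k) *
            (a \<bullet> (aggregate \<omega> (S k w) (T k w) *v a) - a \<bullet> (aggregate \<omega> (cS k) (cT k) *v a)) =
         u \<bullet> snd (0 :: real, sqrt (real (N k) * h k) *\<^sub>R
           (vech (aggregate \<omega> (S k w) (T k w)) - vech (aggregate \<omega> (cS k) (cT k))))"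
        \<comment> \<open>Both the aggregated estimator and its centering are symmetric, so each
          quadratic form is the functional \<open>u\<close> of a \<open>vech\<close>.\<close>
        by (intro always_eventually allI ballI)
          (simp add: u_def quadratic_form_eq_inner_vech[OF transpose_aggregate]
            S_sym T_sym centering inner_diff_right)
    qed (auto intro!: continuous_intros linearI
        simp: inner_simps matrix_vector_mult_scaleR scaleR_matrix_vector_assoc[symmetric])
  qed

  show ?thesis
    using agg_normal w01 \<psi>_le quadratic \<psi>_less[of 0] \<psi>_less[of 1] by auto
qed

end
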